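(* Let $f,g,h$ be integers. If $2\le f<g\le h$, or if $f=g=h\ge 2$, then $n(f,g,h)=2h-f$.
   Context: All graphs are finite, simple and undirected. A complete $k$-coloring of a graph $G=(V,E)$ is a map $\varphi:V\to\{1,\dots,k\}$, using all $k$ colors, such that adjacent vertices get different colors and for any two colors $i\neq j$ there is an edge between the color classes $i$ and $j$. The chromatic number $\chi(G)$ is the minimum number of colors in a proper coloring; the achromatic number $\psi(G)$ is the maximum $k$ for which $G$ has a complete $k$-coloring. A Grundy coloring is a proper coloring $\varphi:V\to\{1,\dots,k\}$ such that every vertex $v$ has a neighbor of color $i$ for every $1\le i<\varphi(v)$; the Grundy number $\Gamma(G)$ is the largest $k$ for which $G$ has a Grundy coloring with $k$ colors. For integers $2\le f\le g\le h$ such that a connected graph $G$ with $\chi(G)=f$, $\Gamma(G)=g$, $\psi(G)=h$ exists, $n(f,g,h)$ denotes the minimum number of vertices of such a connected graph. *)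

theory Defs
  imports "Graph_Theory.Graph_Theory"
begin

text \<open>
  Finite simple undirected graphs are the \<^locale>\<open>pair_graph\<close>s of the AFP: finite, loop-free,
  symmetric arc sets without parallel arcs; an undirected edge is a pair of opposite arcs.
\<close>

definition proper_coloring :: "'a pair_pre_digraph \<Rightarrow> nat \<Rightarrow> ('a \<Rightarrow> nat) \<Rightarrow> bool" where
  "proper_coloring G k c \<longleftrightarrow>
     c ` pverts G \<subseteq> {1..k} \<and> (\<forall>(u, v) \<in> parcs G. c u \<noteq> c v)"

definition complete_coloring :: "'a pair_pre_digraph \<Rightarrow> nat \<Rightarrow> ('a \<Rightarrow> nat) \<Rightarrow> bool" where
  "complete_coloring G k c \<longleftrightarrow>
     proper_coloring G k c \<and> c ` pverts G = {1..k} \<and>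
     (\<forall>i \<in> {1..k}. \<forall>j \<in> {1..k}. i \<noteq> j \<longrightarrow>
        (\<exists>(u, v) \<in> parcs G. c u = i \<and> c v = j))"

text \<open>
  A Grundy coloring with \<open>k\<close> colors has to use color \<open>k\<close> (and then all colors below): otherwise
  \<open>k\<close> could be increased at will and there would be no largest one.
\<close>

definition grundy_coloring :: "'a pair_pre_digraph \<Rightarrow> nat \<Rightarrow> ('a \<Rightarrow> nat) \<Rightarrow> bool" where
  "grundy_coloring G k c \<longleftrightarrow>
     proper_coloring G k c \<and> c ` pverts G = {1..k} \<and>
     (\<forall>v \<in> pverts G. \<forall>i. 1 \<le> i \<and> i < c v \<longrightarrow> (\<exists>u. (v, u) \<in> parcs G \<and> c u = i))"

definition chromatic_number :: "'a pair_pre_digraph \<Rightarrow> nat" where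
  "chromatic_number G = (LEAST k. \<exists>c. proper_coloring G k c)"

definition achromatic_number :: "'a pair_pre_digraph \<Rightarrow> nat" where
  "achromatic_number G = (GREATEST k. \<exists>c. complete_coloring G k c)"

definition grundy_number :: "'a pair_pre_digraph \<Rightarrow> nat" where
  "grundy_number G = (GREATEST k. \<exists>c. grundy_coloring G k c)"

definition realizes :: "'a pair_pre_digraph \<Rightarrow> nat \<Rightarrow> nat \<Rightarrow> nat \<Rightarrow> bool" where
  "realizes G f g h \<longleftrightarrow>
     pair_graph G \<and> connected (with_proj G) \<and>
     chromatic_number G = f \<and> grundy_number G = g \<and> achromatic_number G = h"

text \<open>
  Every finite graph is isomorphic to one whose vertices are natural numbers, so the minimum
  over all graphs can be taken over vertex type \<^typ>\<open>nat\<close> (see \<open>realizes_nat\<close> below).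
  If no graph realizes \<open>(f, g, h)\<close> the value is unspecified.
\<close>

definition min_order :: "nat \<Rightarrow> nat \<Rightarrow> nat \<Rightarrow> nat" where
  "min_order f g h =
     (LEAST n. \<exists>G :: nat pair_pre_digraph. realizes G f g h \<and> card (pverts G) = n)"

lemma ex_coloring_transfer:
  assumes inj: "inj_on \<pi> (pverts G)" and wf: "pair_wf_digraph G"
  defines "H \<equiv> \<lparr>pverts = \<pi> ` pverts G, parcs = map_prod \<pi> \<pi> ` parcs G\<rparr>"
  shows "(\<exists>c. proper_coloring H k c) \<longleftrightarrow> (\<exists>c. proper_coloring G k c)"
    and "(\<exists>c. complete_coloring H k c) \<longleftrightarrow> (\<exists>c. complete_coloring G k c)"
    and "(\<exists>c. grundy_coloring H k c) \<longleftrightarrow> (\<exists>c. grundy_coloring G k c)"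
proof -
  let ?r = "the_inv_into (pverts G) \<pi>"
  have ends: "u \<in> pverts G" "v \<in> pverts G" if "(u, v) \<in> parcs G" for u v
    using pair_wf_digraph.in_arcsD1[OF wf that] pair_wf_digraph.in_arcsD2[OF wf that] by auto
  have inv: "?r (\<pi> u) = u" if "u \<in> pverts G" for u
    using that inj by (simp add: the_inv_into_f_f)
  have arc: "(\<pi> u, y) \<in> parcs H \<longleftrightarrow> (\<exists>v. y = \<pi> v \<and> (u, v) \<in> parcs G)" if "u \<in> pverts G" for u y
  proof
    assume "(\<pi> u, y) \<in> parcs H"
    then obtain a b where ab: "(a, b) \<in> parcs G" "\<pi> u = \<pi> a" "y = \<pi> b"
      unfolding H_def by auto
    moreover have "u = a" using inj_onD[OF inj ab(2) that ends(1)[OF ab(1)]] .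
    ultimately show "\<exists>v. y = \<pi> v \<and> (u, v) \<in> parcs G" by blast
  next
    assume "\<exists>v. y = \<pi> v \<and> (u, v) \<in> parcs G"
    then show "(\<pi> u, y) \<in> parcs H" unfolding H_def by force
  qed
  have img: "(c \<circ> \<pi>) ` pverts G = c ` pverts H" for c :: "'b \<Rightarrow> nat"
    by (simp add: H_def image_comp)
  have P: "proper_coloring H k c \<longleftrightarrow> proper_coloring G k (c \<circ> \<pi>)" for c
    unfolding proper_coloring_def img by (auto simp: H_def)
  have C: "complete_coloring H k c \<longleftrightarrow> complete_coloring G k (c \<circ> \<pi>)" for c
    unfolding complete_coloring_def P img by (simp add: H_def split_beta)
  have N: "(\<exists>u. (\<pi> v, u) \<in> parcs H \<and> c u = i) \<longleftrightarrow> (\<exists>u. (v, u) \<in> parcs G \<and> (c \<circ> \<pi>) u = i)"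
    if "v \<in> pverts G" for v i and c :: "'b \<Rightarrow> nat"
    using arc[OF that] by auto
  have Gr: "grundy_coloring H k c \<longleftrightarrow> grundy_coloring G k (c \<circ> \<pi>)" for c
    unfolding grundy_coloring_def P img using N[of _ c]
    by (simp add: H_def)
  have bk: "proper_coloring G k ((c \<circ> ?r) \<circ> \<pi>) = proper_coloring G k c"
    "complete_coloring G k ((c \<circ> ?r) \<circ> \<pi>) = complete_coloring G k c"
    "grundy_coloring G k ((c \<circ> ?r) \<circ> \<pi>) = grundy_coloring G k c" for c
  proof -
    have e: "((c \<circ> ?r) \<circ> \<pi>) u = c u" if "u \<in> pverts G" for u using inv[OF that] by simp
    have i: "((c \<circ> ?r) \<circ> \<pi>) ` pverts G = c ` pverts G" using e by (rule image_cong[OF refl])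
    show p: "proper_coloring G k ((c \<circ> ?r) \<circ> \<pi>) = proper_coloring G k c"
      unfolding proper_coloring_def i using e ends by (auto simp del: comp_apply split: prod.splits)
    have "(\<exists>(u, v)\<in>parcs G. ((c \<circ> ?r) \<circ> \<pi>) u = i \<and> ((c \<circ> ?r) \<circ> \<pi>) v = j) \<longleftrightarrow>
          (\<exists>(u, v)\<in>parcs G. c u = i \<and> c v = j)" for i j
      using e ends by (intro bex_cong refl) (auto simp del: comp_apply split: prod.splits)
    then show "complete_coloring G k ((c \<circ> ?r) \<circ> \<pi>) = complete_coloring G k c"
      unfolding complete_coloring_def p i by simp
    have "(\<exists>u. (v, u) \<in> parcs G \<and> ((c \<circ> ?r) \<circ> \<pi>) u = i) \<longleftrightarrow>
          (\<exists>u. (v, u) \<in> parcs G \<and> c u = i)" for i v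
      using e ends by (auto simp del: comp_apply)
    then show "grundy_coloring G k ((c \<circ> ?r) \<circ> \<pi>) = grundy_coloring G k c"
      unfolding grundy_coloring_def p i using e by simp
  qed
  show "(\<exists>c. proper_coloring H k c) \<longleftrightarrow> (\<exists>c. proper_coloring G k c)"
    using P bk(1) by blast
  show "(\<exists>c. complete_coloring H k c) \<longleftrightarrow> (\<exists>c. complete_coloring G k c)"
    using C bk(2) by blast
  show "(\<exists>c. grundy_coloring H k c) \<longleftrightarrow> (\<exists>c. grundy_coloring G k c)"
    using Gr bk(3) by blast
qed

lemma realizes_nat:
  fixes G :: "'a pair_pre_digraph"
  assumes "realizes G f g h"
  shows "\<exists>H :: nat pair_pre_digraph. realizes H f g h \<and> card (pverts H) = card (pverts G)"
proof -
  have pg: "pair_graph G" and con: "connected (with_proj G)"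
    using assms by (auto simp: realizes_def)
  interpret pair_graph G by fact
  obtain \<pi> :: "'a \<Rightarrow> nat" where inj: "inj_on \<pi> (pverts G)"
    using pair_finite_verts finite_imp_inj_to_nat_seg by blast
  define H where "H = \<lparr>pverts = \<pi> ` pverts G, parcs = map_prod \<pi> \<pi> ` parcs G\<rparr>"
  have wf: "pair_wf_digraph G" by unfold_locales
  note tr = ex_coloring_transfer[OF inj wf, folded H_def]
  have pgH: "pair_graph H"
  proof
    show "fst e \<in> pverts H" "snd e \<in> pverts H" if "e \<in> parcs H" for e
      using that in_arcsD1 in_arcsD2 by (auto simp: H_def)
    show "finite (pverts H)" "finite (parcs H)"
      using pair_finite_verts pair_finite_arcs by (auto simp: H_def)
    show "fst e \<noteq> snd e" if "e \<in> parcs H" for e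
    proof -
      from that obtain a b where ab: "(a, b) \<in> parcs G" "e = (\<pi> a, \<pi> b)"
        by (auto simp: H_def)
      then show ?thesis
        using inj_onD[OF inj _ in_arcsD1 in_arcsD2, OF _ ab(1) ab(1)] no_loops'[OF ab(1)] by auto
    qed
    show "symmetric (with_proj H)"
      using arcs_symmetric by (force simp: symmetric_def H_def intro!: symI)
  qed
  have step: "(\<pi> u, \<pi> v) \<in> rtrancl_on (pverts H) (parcs (mk_symmetric (with_proj H)))"
    if "(u, v) \<in> rtrancl_on (pverts G) (parcs (mk_symmetric (with_proj G)))" for u v
    using that
  proof (induction rule: rtrancl_on_induct)
    case base
    then show ?case by (auto simp: H_def intro: rtrancl_on_refl)
  next
    case (step y z)
    then have "(\<pi> y, \<pi> z) \<in> parcs (mk_symmetric (with_proj H))"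
      by (force simp: mk_symmetric_def H_def)
    moreover have "\<pi> z \<in> pverts H" using step by (auto simp: H_def)
    ultimately show ?case using step.IH by (auto intro: rtrancl_on_into_rtrancl_on)
  qed
  have vs: "pverts (mk_symmetric (with_proj K)) = pverts K" for K :: "'c pair_pre_digraph"
    by (simp add: mk_symmetric_def)
  have "connected (with_proj H)"
    using con step
    unfolding connected_def strongly_connected_def reachable_def
    by (auto simp: vs) (auto simp: H_def)
  moreover have "card (pverts H) = card (pverts G)"
    using inj by (simp add: H_def card_image)
  moreover have "chromatic_number H = chromatic_number G"
    "grundy_number H = grundy_number G" "achromatic_number H = achromatic_number G"
    by (simp_all add: chromatic_number_def grundy_number_def achromatic_number_def tr)
  ultimately show ?thesis using assms pgH by (auto simp: realizes_def)
qed

end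

theory Submission
  imports Defs
begin

text \<open>
  In a complete \<open>h\<close>-coloring the singleton classes form a clique, so there are at most \<open>f\<close> of them
  and the order is at least \<open>2h - f\<close>. For equality take \<open>f - 2\<close> universal vertices joined to a
  bipartite graph with parts \<open>x\<^sub>0, \<dots>, x\<^bsub>n-1\<^esub>\<close> and \<open>y\<^sub>1, \<dots>, y\<^sub>n\<close>, which is a half graph
  (\<open>x\<^sub>i\<close> adjacent to \<open>y\<^sub>j\<close> for \<open>i < j\<close>) except that the indices \<open>1, \<dots>, m\<close> span a crown
  (\<open>x\<^sub>i\<close> adjacent to \<open>y\<^sub>j\<close> for \<open>i \<noteq> j\<close>). The classes \<open>{x\<^sub>i, y\<^sub>i}\<close> give a complete
  coloring, and the same counting bound shows that it is optimal. A Grundy coloring is monotone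
  with respect to inclusion of neighborhoods; this forces every color to occur on a universal vertex,
  on \<open>x\<^sub>0\<close> or \<open>y\<^sub>n\<close>, or among \<open>y\<^sub>1, \<dots>, y\<^sub>m\<close>.
\<close>

section \<open>The lower bound\<close>

lemma proper_coloringD:
  assumes "proper_coloring G k c"
  shows "v \<in> pverts G \<Longrightarrow> c v \<in> {1..k}" and "(u, v) \<in> parcs G \<Longrightarrow> c u \<noteq> c v"
  using assms by (auto simp: proper_coloring_def)

lemma proper_coloringI:
  assumes "\<And>v. v \<in> pverts G \<Longrightarrow> c v \<in> {1..k}" "\<And>u v. (u, v) \<in> parcs G \<Longrightarrow> c u \<noteq> c v"
  shows "proper_coloring G k c"
  using assms unfolding proper_coloring_def by blast

text \<open>The top color \<open>k\<close> can be renamed to the missing color \<open>i\<close>; for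
  \<open>i = k\<close> nothing changes. Hence a proper coloring with the fewest colors misses none
  of them.\<close>

lemma proper_coloring_skip:
  assumes "proper_coloring G k c" "i \<in> {1..k}" "i \<notin> c ` pverts G"
    and wf: "pair_wf_digraph G"
  shows "proper_coloring G (k - 1) (\<lambda>v. if c v = k then i else c v)"
proof -
  have ends: "u \<in> pverts G" "v \<in> pverts G" if "(u, v) \<in> parcs G" for u v
    using pair_wf_digraph.in_arcsD1[OF wf that] pair_wf_digraph.in_arcsD2[OF wf that] by auto
  have ne: "c v \<noteq> i" if "v \<in> pverts G" for v using assms(3) that by auto
  have "(if c v = k then i else c v) \<in> {1..k - 1}" if "v \<in> pverts G" for v
  proof -
    have "c v \<in> {1..k}" using assms(1) that by (auto simp: proper_coloring_def)
    then show ?thesis using assms(2) ne[OF that] by auto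
  qed
  moreover have "(if c u = k then i else c u) \<noteq> (if c v = k then i else c v)"
    if "(u, v) \<in> parcs G" for u v
    using ends[OF that] ne that assms(1) by (auto simp: proper_coloring_def)
  ultimately show ?thesis unfolding proper_coloring_def by blast
qed

text \<open>A proper coloring with the fewest colors is complete, since two classes without an edge
  between them could be merged. Existence is what gives the \<open>GREATEST\<close> of the
  achromatic number a meaning.\<close>

lemma ex_complete_coloring:
  assumes "pair_graph G"
  shows "\<exists>k c. complete_coloring G k c"
proof -
  interpret pair_graph G by fact
  have wf: "pair_wf_digraph G" by unfold_locales
  obtain \<pi> :: "'a \<Rightarrow> nat" and N where \<pi>: "inj_on \<pi> (pverts G)" "\<pi> ` pverts G = {i. i < N}"
    using finite_imp_inj_to_nat_seg[OF pair_finite_verts] by blast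
  have "proper_coloring G N (\<lambda>v. Suc (\<pi> v))"
    unfolding proper_coloring_def
  proof (intro conjI)
    have "\<pi> v < N" if "v \<in> pverts G" for v using \<pi>(2) that by blast
    then show "(\<lambda>v. Suc (\<pi> v)) ` pverts G \<subseteq> {1..N}" by fastforce
    show "\<forall>(u, v)\<in>parcs G. Suc (\<pi> u) \<noteq> Suc (\<pi> v)"
      using \<pi>(1) in_arcsD1 in_arcsD2 no_loops' by (fastforce dest: inj_onD)
  qed
  then have ex: "\<exists>k c. proper_coloring G k c" by blast
  define k where "k = (LEAST k. \<exists>c. proper_coloring G k c)"
  obtain c where c: "proper_coloring G k c"
    using LeastI_ex[OF ex] unfolding k_def by blast
  have no_skip: "c' ` pverts G = {1..k}" if "proper_coloring G k c'" for c'
  proof (rule ccontr)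
    assume "c' ` pverts G \<noteq> {1..k}"
    moreover have "c' ` pverts G \<subseteq> {1..k}" using that by (simp add: proper_coloring_def)
    ultimately obtain i where i: "i \<in> {1..k}" "i \<notin> c' ` pverts G"
      by blast
    then have "k \<le> k - 1"
      using proper_coloring_skip[OF that i wf] Least_le unfolding k_def by metis
    \<comment> \<open>With truncated subtraction \<open>k <= k - 1\<close> holds at 0; the color
      \<open>i\<close> in \<open>{1..k}\<close> excludes that case.\<close>
    then show False using i by simp
  qed
  have "\<exists>(u, v)\<in>parcs G. c u = i \<and> c v = j"
    if ij: "i \<in> {1..k}" "j \<in> {1..k}" "i \<noteq> j" for i j
  proof (rule ccontr)
    assume no: "\<not> ?thesis"
    let ?c = "\<lambda>v. if c v = i then j else c v"
    have "?c u \<noteq> ?c v" if uv: "(u, v) \<in> parcs G" for u v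
    proof -
      have "c u \<noteq> c v" using c uv unfolding proper_coloring_def by blast
      moreover have "\<not> (c u = i \<and> c v = j)" using no uv by blast
      moreover have "\<not> (c v = i \<and> c u = j)" using no arcs_symmetric[OF uv] by blast
      ultimately show ?thesis by auto
    qed
    moreover have "?c v \<in> {1..k}" if "v \<in> pverts G" for v
      using proper_coloringD(1)[OF c that] ij by simp
    ultimately have "?c ` pverts G = {1..k}"
      by (intro no_skip proper_coloringI)
    moreover have "i \<notin> ?c ` pverts G" using ij by auto
    ultimately show False using ij by blast
  qed
  then show ?thesis
    using c no_skip[OF c] unfolding complete_coloring_def by blast
qed

text \<open>Singleton classes are pairwise adjacent, so \<open>d\<close> separates them and there
  are at most \<open>f\<close>; every other class has two or more vertices. An arbitrary proper
  coloring \<open>d\<close> is allowed so that the bound also caps the achromatic number of the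
  extremal graphs.\<close>

lemma complete_coloring_order:
  assumes pg: "pair_graph G" and c: "complete_coloring G k c" and d: "proper_coloring G f d"
  shows "2 * k \<le> card (pverts G) + f"
proof -
  interpret pair_graph G by fact
  define cl where "cl i = {v \<in> pverts G. c v = i}" for i
  define S where "S = {i \<in> {1..k}. card (cl i) = 1}"
  define s where "s i = the_elem (cl i)" for i
  have fin: "finite (cl i)" for i using pair_finite_verts by (simp add: cl_def)
  have s: "cl i = {s i}" if "i \<in> S" for i
  proof -
    have "card (cl i) = 1" using that by (simp add: S_def)
    then obtain v where "cl i = {v}" by (rule card_1_singletonE)
    then show ?thesis by (simp add: s_def)
  qed
  have "inj_on (d \<circ> s) S"
  proof
    fix i j assume ij: "i \<in> S" "j \<in> S" "(d \<circ> s) i = (d \<circ> s) j"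
    show "i = j"
    proof (rule ccontr)
      assume "i \<noteq> j"
      then obtain u v where uv: "(u, v) \<in> parcs G" "c u = i" "c v = j"
        using c ij unfolding complete_coloring_def S_def mem_Collect_eq by blast
      then have "u \<in> cl i" "v \<in> cl j" using in_arcsD1 in_arcsD2 by (auto simp: cl_def)
      then have "u = s i" "v = s j" using s ij by auto
      then show False using proper_coloringD(2)[OF d uv(1)] ij(3) by simp
    qed
  qed
  moreover have "(d \<circ> s) ` S \<subseteq> {1..f}"
  proof -
    have "s i \<in> pverts G" if "i \<in> S" for i using s[OF that] by (auto simp: cl_def)
    then show ?thesis using d by (auto simp: proper_coloring_def)
  qed
  ultimately have Sf: "card S \<le> f"
    using card_inj_on_le[of "d \<circ> s" S "{1..f}"] by simp
  \<comment> \<open>The indicator supplies the second vertex that a singleton class lacks; summed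
    over all colors it costs \<open>card S\<close>.\<close>
  have ge: "2 \<le> card (cl i) + (if i \<in> S then 1 else 0)" if "i \<in> {1..k}" for i
  proof -
    have "i \<in> c ` pverts G" using c that by (simp add: complete_coloring_def)
    then have "cl i \<noteq> {}" by (auto simp: cl_def)
    then have "card (cl i) \<noteq> 0" using fin by simp
    then show ?thesis using that unfolding S_def by auto
  qed
  have "2 * k = (\<Sum>i\<in>{1..k}. 2)" by simp
  also have "\<dots> \<le> (\<Sum>i\<in>{1..k}. card (cl i) + (if i \<in> S then 1 else 0))"
    using ge by (rule sum_mono)
  also have "\<dots> = (\<Sum>i\<in>{1..k}. card (cl i)) + card S"
  proof -
    have "{1..k} \<inter> S = S" by (auto simp: S_def)
    then show ?thesis by (simp add: sum.distrib sum.If_cases)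
  qed
  also have "(\<Sum>i\<in>{1..k}. card (cl i)) = card (\<Union>i\<in>{1..k}. cl i)"
    using fin by (subst card_UN_disjoint) (auto simp: cl_def)
  also have "(\<Union>i\<in>{1..k}. cl i) = pverts G"
    using c by (auto simp: cl_def complete_coloring_def)
  finally show ?thesis using Sf by simp
qed

lemma realizes_order:
  assumes "realizes G f g h"
  shows "2 * h - f \<le> card (pverts G)"
proof -
  have pg: "pair_graph G" using assms by (simp add: realizes_def)
  obtain k c where kc: "complete_coloring G k c" using ex_complete_coloring[OF pg] by blast
  then have "\<exists>k d. proper_coloring G k d" by (auto simp: complete_coloring_def)
  from LeastI_ex[OF this] obtain d where d: "proper_coloring G f d"
    using assms unfolding realizes_def chromatic_number_def by blast
  \<comment> \<open>The \<open>GREATEST\<close> is attained because the counting bound itself limits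
    the number of colors.\<close>
  have "\<exists>c. complete_coloring G h c"
  proof -
    have "k' \<le> card (pverts G) + f" if "\<exists>c. complete_coloring G k' c" for k'
      using that complete_coloring_order[OF pg _ d] by fastforce
    then have "\<exists>c. complete_coloring G (GREATEST k. \<exists>c. complete_coloring G k c) c"
      using kc by (intro GreatestI_nat[of "\<lambda>k. \<exists>c. complete_coloring G k c" k]) auto
    then show ?thesis using assms by (simp add: realizes_def achromatic_number_def)
  qed
  then show ?thesis using complete_coloring_order[OF pg _ d] by fastforce
qed

section \<open>The extremal graphs\<close>

datatype vertex = U nat | X nat | Y nat

text \<open>In the disjunct \<open>j < i \<and> i \<le> m\<close> the bound on \<open>i\<close>
  bounds \<open>j\<close> as well, so only pairs inside the crown are added to the half
  graph.\<close>

fun adjacent :: "nat \<Rightarrow> vertex \<Rightarrow> vertex \<Rightarrow> bool" where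
  "adjacent m (U a) (U b) \<longleftrightarrow> a \<noteq> b"
| "adjacent m (U a) (X i) \<longleftrightarrow> True"
| "adjacent m (U a) (Y j) \<longleftrightarrow> True"
| "adjacent m (X i) (U a) \<longleftrightarrow> True"
| "adjacent m (Y j) (U a) \<longleftrightarrow> True"
| "adjacent m (X i) (Y j) \<longleftrightarrow> i < j \<or> j < i \<and> i \<le> m"
| "adjacent m (Y j) (X i) \<longleftrightarrow> i < j \<or> j < i \<and> i \<le> m"
| "adjacent m (X i) (X j) \<longleftrightarrow> False"
| "adjacent m (Y i) (Y j) \<longleftrightarrow> False"

text \<open>Because the \<open>X\<close> indices start at 0 and the \<open>Y\<close> indices end at
  \<open>n\<close>, \<open>X 0\<close> sees every \<open>Y\<close> and \<open>Y n\<close> sees every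
  \<open>X\<close>.\<close>

definition extremal_graph :: "nat \<Rightarrow> nat \<Rightarrow> nat \<Rightarrow> vertex pair_pre_digraph" where
  "extremal_graph r m n =
     (let V = U ` {..<r} \<union> X ` {..<n} \<union> Y ` {1..n}
      in \<lparr>pverts = V, parcs = {(u, v) \<in> V \<times> V. adjacent m u v}\<rparr>)"

lemma adjacent_sym: "adjacent m u v \<Longrightarrow> adjacent m v u"
  by (cases u; cases v) auto

lemma adjacent_irrefl: "\<not> adjacent m u u"
  by (cases u) auto

lemma pverts_extremal:
  "pverts (extremal_graph r m n) = U ` {..<r} \<union> X ` {..<n} \<union> Y ` {1..n}"
  by (simp add: extremal_graph_def Let_def)

lemma mem_pverts_extremal [simp]:
  "U a \<in> pverts (extremal_graph r m n) \<longleftrightarrow> a < r"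
  "X i \<in> pverts (extremal_graph r m n) \<longleftrightarrow> i < n"
  "Y j \<in> pverts (extremal_graph r m n) \<longleftrightarrow> 1 \<le> j \<and> j \<le> n"
  by (auto simp: pverts_extremal)

lemma parcs_extremal:
  "(u, v) \<in> parcs (extremal_graph r m n) \<longleftrightarrow>
     u \<in> pverts (extremal_graph r m n) \<and> v \<in> pverts (extremal_graph r m n) \<and> adjacent m u v"
  by (simp add: extremal_graph_def Let_def)

lemma card_extremal: "card (pverts (extremal_graph r m n)) = r + 2 * n"
proof -
  have "card (pverts (extremal_graph r m n)) =
      card (U ` {..<r}) + card (X ` {..<n}) + card (Y ` {1..n})"
    unfolding pverts_extremal by (subst card_Un_disjoint; auto)+
  then show ?thesis by (simp add: card_image inj_on_def)
qed

lemma pair_graph_extremal: "pair_graph (extremal_graph r m n)"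
proof
  let ?G = "extremal_graph r m n"
  show "fst e \<in> pverts ?G" "snd e \<in> pverts ?G" if "e \<in> parcs ?G" for e
    using that by (cases e; simp add: parcs_extremal)+
  show fin: "finite (pverts ?G)" by (simp add: pverts_extremal)
  have "parcs ?G \<subseteq> pverts ?G \<times> pverts ?G" by (auto simp: extremal_graph_def Let_def)
  then show "finite (parcs ?G)" by (rule finite_subset) (simp add: fin)
  show "fst e \<noteq> snd e" if "e \<in> parcs ?G" for e
    using that adjacent_irrefl by (cases e) (auto simp: parcs_extremal)
  show "symmetric (with_proj ?G)"
    using adjacent_sym by (auto simp: symmetric_def parcs_extremal intro!: symI)
qed

lemma connected_extremal:
  assumes "0 < n"
  shows "connected (with_proj (extremal_graph r m n))"
proof -
  let ?G = "extremal_graph r m n"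
  interpret pair_graph ?G by (rule pair_graph_extremal)
  have x0: "X 0 \<in> pverts ?G" using assms by auto
  have adj: "u \<rightarrow>\<^sup>*\<^bsub>with_proj ?G\<^esub> v" if "(u, v) \<in> parcs ?G" for u v
    using that by (simp add: reachable_adjI)
  have x0_yn: "(X 0, Y n) \<in> parcs ?G" using assms by (auto simp: parcs_extremal)
  have from_x0: "X 0 \<rightarrow>\<^sup>*\<^bsub>with_proj ?G\<^esub> v" if v: "v \<in> pverts ?G" for v
  proof (cases v)
    case (X i)
    then have "(Y n, v) \<in> parcs ?G" using v by (auto simp: parcs_extremal)
    then show ?thesis using adj x0_yn reachable_trans by blast
  next
    case (U a)
    then have "(X 0, v) \<in> parcs ?G" using v x0 by (auto simp: parcs_extremal)
    then show ?thesis by (rule adj)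
  next
    case (Y j)
    then have "(X 0, v) \<in> parcs ?G" using v x0 by (auto simp: parcs_extremal)
    then show ?thesis by (rule adj)
  qed
  have "strongly_connected (with_proj ?G)"
  proof (rule strongly_connectedI)
    show "verts (with_proj ?G) \<noteq> {}" using x0 unfolding with_proj_simps by blast
    fix u v assume "u \<in> verts (with_proj ?G)" "v \<in> verts (with_proj ?G)"
    then show "u \<rightarrow>\<^sup>*\<^bsub>with_proj ?G\<^esub> v"
      using from_x0 reachable_trans symmetric_reachable[OF sym_arcs] by (metis with_proj_simps(1))
  qed
  then show ?thesis
    by (simp add: connected_def strongly_connected_def reachable_mk_symmetric_eq[OF sym_arcs])
qed

section \<open>Chromatic and achromatic numbers of the extremal graphs\<close>

lemma chromatic_extremal:
  assumes "0 < n"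
  shows "chromatic_number (extremal_graph r m n) = r + 2"
    and "\<exists>c. proper_coloring (extremal_graph r m n) (r + 2) c"
proof -
  let ?G = "extremal_graph r m n"
  define c where "c v = (case v of X i \<Rightarrow> 1 | Y j \<Rightarrow> 2 | U a \<Rightarrow> a + 3)" for v
  have c: "proper_coloring ?G (r + 2) c"
    unfolding proper_coloring_def by (fastforce simp: c_def parcs_extremal pverts_extremal)
  then show "\<exists>c. proper_coloring ?G (r + 2) c" by blast
  have "r + 2 \<le> k" if "proper_coloring ?G k d" for k d
  proof -
    \<comment> \<open>A clique on \<open>r + 2\<close> vertices.\<close>
    let ?K = "insert (X 0) (insert (Y n) (U ` {..<r}))"
    have "adjacent m u v" if "u \<in> ?K" "v \<in> ?K" "u \<noteq> v" for u v
      using that assms by auto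
    moreover have sub: "?K \<subseteq> pverts ?G" using assms by auto
    ultimately have "(u, v) \<in> parcs ?G" if "u \<in> ?K" "v \<in> ?K" "u \<noteq> v" for u v
      using that unfolding parcs_extremal by blast
    then have "inj_on d ?K"
      using that unfolding proper_coloring_def inj_on_def by blast
    moreover have "d ` ?K \<subseteq> {1..k}"
      using that sub unfolding proper_coloring_def by blast
    ultimately have "card ?K \<le> k"
      using card_inj_on_le[of d ?K "{1..k}"] by simp
    moreover have "card ?K = r + 2"
      by (auto simp: card_insert_if card_image inj_on_def)
    ultimately show ?thesis by simp
  qed
  then show "chromatic_number ?G = r + 2"
    unfolding chromatic_number_def using c by (intro Least_equality) auto
qed

lemma achromatic_extremal:
  assumes "0 < n"
  shows "achromatic_number (extremal_graph r m n) = r + n + 1"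
proof -
  let ?G = "extremal_graph r m n"
  \<comment> \<open>The singleton classes are \<open>X 0\<close>, \<open>Y n\<close> and the
    \<open>U a\<close>; the others are the pairs \<open>X i\<close>, \<open>Y i\<close>.\<close>
  define c where "c v = (case v of X i \<Rightarrow> i + 1 | Y j \<Rightarrow> j + 1 | U a \<Rightarrow> n + 2 + a)" for v
  \<comment> \<open>For \<open>i < j\<close> the edge joins \<open>w i\<close> to
    \<open>w' j\<close>, using only half-graph edges and edges at universal vertices. The non-vertex
    \<open>w' 1\<close> never arises, as \<open>j\<close> is at least 2.\<close>
  define w where "w i = (if i \<le> n then X (i - 1) else if i = n + 1 then Y n else U (i - (n + 2)))"
    for i
  define w' where "w' i = (if i \<le> n + 1 then Y (i - 1) else U (i - (n + 2)))" for i
  have proper: "proper_coloring ?G (r + n + 1) c"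
    unfolding proper_coloring_def by (fastforce simp: c_def parcs_extremal pverts_extremal)
  have edge: "\<exists>(u, v)\<in>parcs ?G. c u = i \<and> c v = j"
    if "1 \<le> i" "i < j" "j \<le> r + n + 1" for i j
  proof -
    have "w i \<in> pverts ?G" "w' j \<in> pverts ?G" using that assms by (auto simp: w_def w'_def)
    moreover have "adjacent m (w i) (w' j)" using that by (auto simp: w_def w'_def)
    ultimately have "(w i, w' j) \<in> parcs ?G" by (simp only: parcs_extremal)
    moreover have "c (w i) = i" "c (w' j) = j" using that by (auto simp: w_def w'_def c_def)
    ultimately show ?thesis by blast
  qed
  have sym: "(u, v) \<in> parcs ?G \<Longrightarrow> (v, u) \<in> parcs ?G" for u v
    using adjacent_sym by (auto simp: parcs_extremal)
  have "complete_coloring ?G (r + n + 1) c"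
    unfolding complete_coloring_def
  proof (intro conjI ballI impI)
    show "proper_coloring ?G (r + n + 1) c" by fact
    have "i \<in> c ` pverts ?G" if "i \<in> {1..r + n + 1}" for i
    proof -
      have "w i \<in> pverts ?G" "c (w i) = i" using that assms by (auto simp: w_def c_def)
      then show ?thesis by (metis imageI)
    qed
    then show "c ` pverts ?G = {1..r + n + 1}"
      using proper unfolding proper_coloring_def by blast
    fix i j assume "i \<in> {1..r + n + 1}" "j \<in> {1..r + n + 1}" "i \<noteq> j"
    then consider "1 \<le> i" "i < j" "j \<le> r + n + 1" | "1 \<le> j" "j < i" "i \<le> r + n + 1"
      by fastforce
    then show "\<exists>(u, v)\<in>parcs ?G. c u = i \<and> c v = j"
      by cases (use edge sym in blast)+
  qed
  moreover have "k \<le> r + n + 1" if "\<exists>c. complete_coloring ?G k c" for k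
  proof -
    obtain d where "proper_coloring ?G (r + 2) d" using chromatic_extremal(2)[OF assms] by blast
    with that have "2 * k \<le> card (pverts ?G) + (r + 2)"
      using complete_coloring_order[OF pair_graph_extremal] by blast
    then show ?thesis unfolding card_extremal by simp
  qed
  ultimately show ?thesis
    unfolding achromatic_number_def by (intro Greatest_equality) auto
qed

section \<open>Grundy number of the extremal graphs\<close>

text \<open>If \<open>u\<close> had the larger color, it would have a neighbor of color
  \<open>c v\<close>, which would also be a neighbor of \<open>v\<close>.\<close>

lemma grundy_coloring_mono:
  assumes c: "grundy_coloring G k c" and uv: "u \<in> pverts G" "v \<in> pverts G"
    and nbh: "\<And>w. (u, w) \<in> parcs G \<Longrightarrow> (v, w) \<in> parcs G"
  shows "c u \<le> c v"
proof (rule ccontr)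
  assume "\<not> c u \<le> c v"
  moreover have "1 \<le> c v" using c uv by (auto simp: grundy_coloring_def)
  ultimately obtain w where "(u, w) \<in> parcs G" "c w = c v"
    using c uv unfolding grundy_coloring_def by (meson not_le)
  then show False
    using nbh proper_coloringD(2) c unfolding grundy_coloring_def by metis
qed

lemma grundy_extremal_ge:
  assumes "m < n" and m: "0 < m \<or> n = 1"
  shows "\<exists>c. grundy_coloring (extremal_graph r m n) (r + m + 2) c"
proof -
  let ?G = "extremal_graph r m n"
  \<comment> \<open>Inside the crown \<open>X i\<close> and \<open>Y i\<close> share color
    \<open>i\<close>. An \<open>X i\<close> with \<open>i > m\<close> can take color 1: its
    \<open>Y\<close> neighbors all have index above \<open>m\<close>, hence color
    \<open>m + 2\<close>.\<close>
  define c where "c v = (case v of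
      X i \<Rightarrow> if i = 0 then m + 1 else if i \<le> m then i else 1
    | Y j \<Rightarrow> if j \<le> m then j else m + 2
    | U a \<Rightarrow> m + 3 + a)" for v
  \<comment> \<open>A vertex of color \<open>i\<close> adjacent to every \<open>X\<close> or
    \<open>U\<close> vertex of larger color; the \<open>Y\<close> vertices get their own witness
    \<open>u\<close> below.\<close>
  define w where "w i = (if i \<le> m then Y i else if i = m + 1 then X 0
      else if i = m + 2 then Y n else U (i - (m + 3)))" for i
  have w: "w i \<in> pverts ?G" "c (w i) = i" if "1 \<le> i" "i \<le> r + m + 2" for i
    using that \<open>m < n\<close> by (auto simp: w_def c_def)
  have proper: "proper_coloring ?G (r + m + 2) c"
    unfolding proper_coloring_def
  proof (intro conjI)
    show "c ` pverts ?G \<subseteq> {1..r + m + 2}" by (auto simp: c_def pverts_extremal)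
    have "c u \<noteq> c v" if "(u, v) \<in> parcs ?G" for u v
      using that m by (cases u; cases v) (auto simp: c_def parcs_extremal split: if_splits)
    then show "\<forall>(u, v)\<in>parcs ?G. c u \<noteq> c v" by blast
  qed
  have "\<exists>u. (v, u) \<in> parcs ?G \<and> c u = i"
    if v: "v \<in> pverts ?G" and i: "1 \<le> i" "i < c v" for v i
  proof -
    have "c v \<in> {1..r + m + 2}" using proper v unfolding proper_coloring_def by blast
    then have wi: "w i \<in> pverts ?G" "c (w i) = i" using w i by auto
    show ?thesis
    proof (cases v)
      case (X j)
      then have "adjacent m v (w i)" using i v by (auto simp: c_def w_def split: if_splits)
      then show ?thesis using wi v by (auto simp: parcs_extremal)
    next
      case (U a)
      then have "adjacent m v (w i)" using i v by (auto simp: c_def w_def split: if_splits)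
      then show ?thesis using wi v by (auto simp: parcs_extremal)
    next
      case (Y j)
      define u where "u = (if i = m + 1 then X 0 else X i)"
      have "u \<in> pverts ?G" "adjacent m v u" "c u = i"
        using Y i v assms by (auto simp: c_def u_def split: if_splits)
      then show ?thesis using v by (auto simp: parcs_extremal)
    qed
  qed
  moreover have "c ` pverts ?G = {1..r + m + 2}"
  proof
    show "c ` pverts ?G \<subseteq> {1..r + m + 2}" using proper by (simp add: proper_coloring_def)
    show "{1..r + m + 2} \<subseteq> c ` pverts ?G" using w by (metis atLeastAtMost_iff imageI subsetI)
  qed
  ultimately have "grundy_coloring ?G (r + m + 2) c"
    using proper unfolding grundy_coloring_def by blast
  then show ?thesis by blast
qed

text \<open>The set \<open>?W\<close> has at most \<open>r + m + 2\<close> vertices. A color missing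
  from it would occur on some \<open>X a\<close> and some \<open>Y b\<close> outside the crown, and
  then \<open>X a\<close> would have no neighbor of the smaller color
  \<open>c (Y 1)\<close>.\<close>

lemma grundy_extremal_le:
  assumes mn: "m < n" and m: "0 < m \<or> n = 1"
    and c: "grundy_coloring (extremal_graph r m n) k c"
  shows "k \<le> r + m + 2"
proof -
  let ?G = "extremal_graph r m n"
  let ?W = "insert (X 0) (insert (Y n) (U ` {..<r} \<union> Y ` {1..m}))"
  have pc: "proper_coloring ?G k c" using c by (simp add: grundy_coloring_def)
  have proper: "c u \<noteq> c v" if "u \<in> pverts ?G" "v \<in> pverts ?G" "adjacent m u v" for u v
    using proper_coloringD(2)[OF pc] that by (simp add: parcs_extremal)
  have nbr: "\<exists>u \<in> pverts ?G. adjacent m v u \<and> c u = i"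
    if "v \<in> pverts ?G" "1 \<le> i" "i < c v" for v i
    using c that unfolding grundy_coloring_def by (metis parcs_extremal)
  have mono: "c u \<le> c v"
    if "u \<in> pverts ?G" "v \<in> pverts ?G" "\<And>w. w \<in> pverts ?G \<Longrightarrow> adjacent m u w \<Longrightarrow> adjacent m v w"
    for u v
    using grundy_coloring_mono[OF c that(1,2)] that by (auto simp: parcs_extremal)
  have pos: "1 \<le> c v" if "v \<in> pverts ?G" for v
    using proper_coloringD(1)[OF pc that] by simp
  have X_le: "c (X i) \<le> c (X 0)" if "i < n" for i
  proof (rule mono)
    fix w assume "w \<in> pverts ?G" "adjacent m (X i) w"
    then show "adjacent m (X 0) w" by (cases w) auto
  qed (use that in auto)
  \<comment> \<open>Since \<open>m < l\<close>, \<open>Y l\<close> also sees the crown neighbors of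
    \<open>Y j\<close> whose index exceeds \<open>j\<close>.\<close>
  have Y_le: "c (Y j) \<le> c (Y l)" if "1 \<le> j" "j \<le> l" "m < l" "l \<le> n" for j l
  proof (rule mono)
    fix w assume "w \<in> pverts ?G" "adjacent m (Y j) w"
    then show "adjacent m (Y l) w" using that by (cases w) auto
  qed (use that in auto)
  have "i \<in> c ` ?W" if i: "i \<in> {1..k}" for i
  proof (rule ccontr)
    assume no: "i \<notin> c ` ?W"
    have no_U: "c (U a) \<noteq> i" if "a < r" for a using no that by auto
    have no_X0: "c (X 0) \<noteq> i" and no_Yn: "c (Y n) \<noteq> i" using no by auto
    have "i \<in> c ` pverts ?G" using c i by (simp add: grundy_coloring_def)
    then obtain v where v: "v \<in> pverts ?G" "c v = i" by blast
    \<comment> \<open>By monotonicity \<open>Y n\<close> has a color above \<open>i\<close>, so it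
      needs a neighbor of color \<open>i\<close>, which must be an \<open>X\<close>;
      \<open>from_X\<close> is the mirror image with \<open>X 0\<close>.\<close>
    have from_Y: "\<exists>a<n. c (X a) = i" if "1 \<le> b" "b \<le> n" "c (Y b) = i" for b
    proof -
      have "i < c (Y n)" using Y_le[of b n] that mn no_Yn by auto
      then obtain u where "u \<in> pverts ?G" "adjacent m (Y n) u" "c u = i"
        using nbr[of "Y n" i] i mn by auto
      then show ?thesis using no_U by (cases u) auto
    qed
    have from_X: "\<exists>b. 1 \<le> b \<and> b \<le> n \<and> c (Y b) = i" if "a < n" "c (X a) = i" for a
    proof -
      have "i < c (X 0)" using X_le[of a] that no_X0 by auto
      then obtain u where "u \<in> pverts ?G" "adjacent m (X 0) u" "c u = i"
        using nbr[of "X 0" i] i mn by auto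
      then show ?thesis using no_U by (cases u) auto
    qed
    obtain a b where a: "a < n" "c (X a) = i" and b: "1 \<le> b" "b \<le> n" "c (Y b) = i"
    proof (cases v)
      case (U a)
      then show ?thesis using v no_U by auto
    next
      case (X a)
      then show ?thesis using that[of a] v from_X[of a] by auto
    next
      case (Y b)
      then show ?thesis using that[of _ b] v from_Y[of b] by auto
    qed
    have "b \<noteq> n" using b no_Yn by auto
    then have "0 < m" using m b by auto
    have "m < b" using no b by (metis UnI2 atLeastAtMost_iff imageI insertCI not_le)
    \<comment> \<open>Equal colors forbid adjacency. Hence \<open>m < a\<close>, and the
      \<open>Y\<close> neighbors of \<open>X a\<close> all have index above \<open>a\<close>, so by
      \<open>Y_le\<close> color at least \<open>i\<close>.\<close>
    have "b \<le> a" using proper[of "X a" "Y b"] a b by (cases "a < b") auto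
    have "c (Y 1) \<noteq> i" using no \<open>0 < m\<close> by auto
    then have "c (Y 1) < i" using Y_le[of 1 b] b \<open>m < b\<close> by simp
    moreover have "1 \<le> c (Y 1)" using pos[of "Y 1"] mn by auto
    ultimately obtain u where u: "u \<in> pverts ?G" "adjacent m (X a) u" "c u = c (Y 1)"
      using nbr[of "X a" "c (Y 1)"] a by auto
    show False
    proof (cases u)
      case (U _)
      then show ?thesis using proper[of u "Y 1"] u mn by auto
    next
      case (X _)
      then show ?thesis using u by auto
    next
      case (Y l)
      then have "b \<le> l" "l \<le> n" using u \<open>b \<le> a\<close> \<open>m < b\<close> by auto
      then show ?thesis using Y_le[of b l] Y u b \<open>m < b\<close> \<open>c (Y 1) < i\<close> by auto
    qed
  qed
  then have "{1..k} \<subseteq> c ` ?W" by blast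
  then have "card {1..k} \<le> card ?W" by (intro surj_card_le) simp_all
  also have "card ?W \<le> Suc (Suc (card (U ` {..<r} \<union> Y ` {1..m})))"
    by (simp add: card_insert_if)
  also have "card (U ` {..<r} \<union> Y ` {1..m}) \<le> r + m"
    using card_Un_le[of "U ` {..<r}" "Y ` {1..m}"] card_image_le[of "{..<r}" U]
      card_image_le[of "{1..m}" Y] by simp
  finally show ?thesis by simp
qed

lemma grundy_extremal:
  assumes "m < n" "0 < m \<or> n = 1"
  shows "grundy_number (extremal_graph r m n) = r + m + 2"
  unfolding grundy_number_def
  using grundy_extremal_ge[OF assms] grundy_extremal_le[OF assms]
  by (intro Greatest_equality) auto

theorem theorem1:
  fixes f g h :: nat
  assumes "(2 \<le> f \<and> f < g \<and> g \<le> h) \<or> (f = g \<and> g = h \<and> 2 \<le> h)"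
  shows "(\<exists>G :: nat pair_pre_digraph. realizes G f g h) \<and> min_order f g h = 2 * h - f"
proof -
  \<comment> \<open>These values solve \<open>f = r + 2\<close>, \<open>g = r + m + 2\<close>,
    \<open>h = r + n + 1\<close>. The case \<open>f = g = h\<close> gives \<open>m = 0\<close> and
    \<open>n = 1\<close>, a complete graph.\<close>
  define r m n where "r = f - 2" and "m = g - f" and "n = h - f + 1"
  have fgh: "f = r + 2" "g = r + m + 2" "h = r + n + 1" and mn: "m < n" "0 < m \<or> n = 1"
    using assms by (auto simp: r_def m_def n_def)
  have "realizes (extremal_graph r m n) f g h"
    unfolding realizes_def fgh
    using mn pair_graph_extremal connected_extremal chromatic_extremal(1) grundy_extremal
      achromatic_extremal by auto
  then obtain G :: "nat pair_pre_digraph" where G: "realizes G f g h" "card (pverts G) = r + 2 * n"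
    using realizes_nat card_extremal by metis
  have "r + 2 * n = 2 * h - f" using fgh by simp
  then have "min_order f g h = 2 * h - f"
    unfolding min_order_def using G realizes_order by (intro Least_equality) auto
  then show ?thesis using G by blast
qed

end
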